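(* Let $(R,\mathfrak{m})$ be a finite commutative local ring with identity, with residue field $R/\mathfrak{m}\simeq \mathbb{F}_q$, where $q$ is a power of a prime $p$. Let $k=p^{h}\ell\in\mathbb{N}$ with $h\ge 0$, $\ell\ge 1$ and $\gcd(\ell,p)=1$. If $|\mathfrak{m}|=p^{t}$, then $$G_R(k)=G_R(k')\qquad\text{with}\qquad k'=p^{\min\{t,h\}}\,\ell'\le k,$$ where $\ell'=\gcd(\ell,q-1)$.
   Context: For a commutative ring $R$ with identity and $k\in\mathbb{N}$ (positive integer), $R^*$ is the group of units and $U_{R,k}=\{x^k:x\in R^*\}$. For an abelian group $A$ and $S\subseteq A$ with $0\notin S$, $X(A,S)$ denotes the Cayley digraph with vertex set $A$ and an arc from $v$ to $w$ iff $w-v\in S$. The $k$-th unitary Cayley graph is $G_R(k)=X(R,U_{R,k})$. Equality of graphs means same vertex set and same arcs. *)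

theory Defs
  imports "HOL-Algebra.QuotRing" "Graph_Theory.Pair_Digraph" "HOL-Computational_Algebra.Primes"
begin

text \<open>
  The pair \<open>(R, M)\<close>: a commutative local ring with identity, \<open>M\<close> being its only maximal ideal.
  Maximal ideals are proper, so \<open>R\<close> is nonzero.
\<close>

locale local_cring = cring R + maximalideal M R for R (structure) and M +
  assumes unique_maximalideal: "maximalideal I R \<Longrightarrow> I = M"

text \<open>
  The group \<open>A\<close> is written multiplicatively, so \<open>w \<otimes> inv v\<close> stands for the difference of
  \<open>w\<close> and \<open>v\<close>; below, \<open>A\<close> is the additive group of a ring.
  Intended for abelian \<open>A\<close> and for \<open>S\<close> contained in \<open>carrier A\<close> and not containing the neutral element.
\<close>

definition cayley_digraph :: "('a, 'm) monoid_scheme \<Rightarrow> 'a set \<Rightarrow> 'a pair_pre_digraph" where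
  "cayley_digraph A S =
    \<lparr>pverts = carrier A,
     parcs = {(v, w). v \<in> carrier A \<and> w \<in> carrier A \<and> w \<otimes>\<^bsub>A\<^esub> inv\<^bsub>A\<^esub> v \<in> S}\<rparr>"

definition unit_powers :: "('a, 'm) ring_scheme \<Rightarrow> nat \<Rightarrow> 'a set" where
  "unit_powers R k = {x [^]\<^bsub>R\<^esub> k | x. x \<in> Units R}"

definition unitary_cayley_graph :: "('a, 'm) ring_scheme \<Rightarrow> nat \<Rightarrow> 'a pair_pre_digraph" where
  "unitary_cayley_graph R k = cayley_digraph (add_monoid R) (unit_powers R k)"

lemma (in cring) parcs_unitary_cayley_graph:
  "parcs (unitary_cayley_graph R k) =
    {(v, w). v \<in> carrier R \<and> w \<in> carrier R \<and> w \<ominus> v \<in> unit_powers R k}"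
  by (simp add: unitary_cayley_graph_def cayley_digraph_def a_minus_def a_inv_def)

lemma (in local_cring) unit_powers_admissible:
  "unit_powers R k \<subseteq> carrier R" "\<zero> \<notin> unit_powers R k"
proof -
  have pow: "x [^] k \<in> Units R" if "x \<in> Units R" for x
    using that by (induction k) auto
  then show "unit_powers R k \<subseteq> carrier R"
    by (auto simp: unit_powers_def)
  show "\<zero> \<notin> unit_powers R k"
  proof
    assume "\<zero> \<in> unit_powers R k"
    then have "\<zero> \<in> Units R"
      using pow by (force simp: unit_powers_def)
    then have "\<one> = \<zero>"
      by (metis Units_inv_closed Units_l_inv r_null)
    then have "carrier R = {\<zero>}"
      by (rule one_zeroD)
    moreover have "\<zero> \<in> M" "M \<subseteq> carrier R"
      using additive_subgroup.zero_closed[OF is_additive_subgroup] a_subset by auto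
    ultimately show False
      using I_notcarr by auto
  qed
qed

end

theory Submission
  imports Defs "HOL-Algebra.Multiplicative_Group"
begin

text \<open>
  The graph \<open>G\<^sub>R(k)\<close> depends only on the set of \<open>k\<close>-th powers in the unit group. In a finite group
  of order \<open>N\<close>, Bezout's identity \<open>a k = b N + gcd(k, N)\<close> makes every \<open>gcd(k, N)\<close>-th power a
  \<open>k\<close>-th power, so that the two sets of powers coincide.

  The units of a local ring are the elements outside the maximal ideal \<open>\<mm>\<close>, and Lagrange's theorem
  for the additive group gives \<open>|R| = |\<mm>| |R/\<mm>| = p\<^sup>t q\<close>; so \<open>N = p\<^sup>t (q - 1)\<close>. As \<open>p\<close> is coprime
  to both \<open>l\<close> and \<open>q - 1\<close>, the \<open>p\<close>-parts and the remaining factors of \<open>k = p\<^sup>h l\<close> and \<open>N\<close> do not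
  interact, and \<open>gcd(k, N) = p\<^bsup>min(t, h)\<^esup> gcd(l, q - 1) = k'\<close>. Being a divisor of \<open>k > 0\<close>, the
  number \<open>k'\<close> is at most \<open>k\<close>.
\<close>

lemma (in group) powers_eq_powers_gcd_order:
  fixes k :: nat
  assumes "finite (carrier G)"
  shows "{x [^] k | x. x \<in> carrier G} = {x [^] gcd k (order G) | x. x \<in> carrier G}"
proof (cases "k = 0")
  case True
  \<comment> \<open>Here \<open>gcd k (order G)\<close> is the order of the group, so that both sets are \<open>{\<one>}\<close>.\<close>
  then show ?thesis
    by (auto simp: pow_order_eq_1 intro!: exI[of _ \<one>])
next
  case False
  define d where "d = gcd k (order G)"
  obtain a b where bezout: "k * a = order G * b + d"
    using bezout_nat[OF False, of "order G"] unfolding d_def by blast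
  obtain c where c: "k = d * c"
    unfolding d_def using gcd_dvd1 by (metis dvdE)
  have "x [^] k = (x [^] c) [^] d" if "x \<in> carrier G" for x
    using that c by (simp add: nat_pow_pow mult.commute)
  moreover have "x [^] d = (x [^] a) [^] k" if x: "x \<in> carrier G" for x
  proof -
    have "(x [^] a) [^] k = (x [^] order G) [^] b \<otimes> x [^] d"
      using x bezout by (simp add: nat_pow_pow nat_pow_mult mult.commute)
    then show ?thesis
      using x by (simp add: pow_order_eq_1)
  qed
  ultimately show ?thesis
    unfolding d_def[symmetric] by (blast intro: nat_pow_closed)
qed

corollary (in monoid) unit_powers_eq_unit_powers_gcd:
  assumes "finite (carrier G)"
  shows "{x [^] k | x. x \<in> Units G} = {x [^] gcd k (card (Units G)) | x. x \<in> Units G}"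
proof -
  interpret U: group "units_of G"
    by (rule units_group)
  have "Units G \<subseteq> carrier G"
    by auto
  then have "finite (carrier (units_of G))"
    using assms by (simp add: units_of_carrier finite_subset)
  then have "{x [^]\<^bsub>units_of G\<^esub> k | x. x \<in> Units G} =
      {x [^]\<^bsub>units_of G\<^esub> gcd k (card (Units G)) | x. x \<in> Units G}"
    using U.powers_eq_powers_gcd_order[of k] by (simp add: units_of_carrier order_def)
  moreover have "{x [^]\<^bsub>units_of G\<^esub> n | x. x \<in> Units G} = {x [^] n | x. x \<in> Units G}" for n :: nat
    by (simp add: units_of_pow cong: rev_conj_cong)
  ultimately show ?thesis
    by simp
qed

lemma (in cring) proper_ideal_subset_maximalideal:
  assumes "finite (carrier R)" and "ideal I R" and "I \<noteq> carrier R"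
  obtains J where "maximalideal J R" and "I \<subseteq> J"
proof -
  let ?P = "{J. ideal J R \<and> J \<noteq> carrier R}"
  have "J \<subseteq> carrier R" if "ideal J R" for J
    using that by (rule additive_subgroup.a_subset[OF ideal.axioms(1)])
  then have "?P \<subseteq> Pow (carrier R)"
    by blast
  then have "finite ?P"
    using assms(1) by (rule finite_subset[OF _ iffD2[OF finite_Pow_iff]])
  moreover have "I \<in> ?P"
    using assms(2,3) by simp
  ultimately have "\<exists>J\<in>?P. I \<subseteq> J \<and> (\<forall>K\<in>?P. J \<subseteq> K \<longrightarrow> J = K)"
    by (rule finite_has_maximal2)
  then obtain J where J: "ideal J R" "J \<noteq> carrier R" "I \<subseteq> J"
    and max: "\<forall>K\<in>?P. J \<subseteq> K \<longrightarrow> J = K"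
    by (elim bexE conjE CollectE) (rule that)
  have "maximalideal J R"
  proof (rule maximalidealI)
    show "ideal J R" and "carrier R \<noteq> J"
      using J(1,2) by auto
    show "K = J \<or> K = carrier R" if "ideal K R" "J \<subseteq> K" for K
      using max that by auto
  qed
  then show thesis
    using J(3) by (rule that)
qed

text \<open>
  A nonunit generates a proper principal ideal, which lies in a maximal ideal, that is, in \<open>\<mm>\<close>.
\<close>

lemma (in local_cring) Units_eq_Diff_maximalideal:
  assumes "finite (carrier R)"
  shows "Units R = carrier R - M"
proof (intro equalityI subsetI)
  fix x
  assume x: "x \<in> Units R"
  have "x \<notin> M"
  proof
    assume "x \<in> M"
    then have "inv x \<otimes> x \<in> M"
      using x by (intro I_l_closed) auto
    then have "M = carrier R"
      using x by (intro one_imp_carrier) simp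
    then show False
      using I_notcarr by simp
  qed
  then show "x \<in> carrier R - M"
    using x by auto
next
  fix x
  assume x: "x \<in> carrier R - M"
  show "x \<in> Units R"
  proof (rule ccontr)
    assume "x \<notin> Units R"
    then have "\<one> \<notin> PIdl x"
      using x by (auto simp: cgenideal_def Units_def m_comm)
    then have "PIdl x \<noteq> carrier R"
      by auto
    then obtain J where "maximalideal J R" and "PIdl x \<subseteq> J"
      using proper_ideal_subset_maximalideal[OF assms] cgenideal_ideal x by blast
    then have "PIdl x \<subseteq> M"
      using unique_maximalideal by blast
    then show False
      using x cgenideal_self by blast
  qed
qed

lemma (in local_cring) card_Units:
  assumes "finite (carrier R)"
  shows "card (Units R) = card M * (card (carrier (R Quot M)) - 1)"
proof -
  have "finite M"
    using a_subset assms by (rule finite_subset)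
  have "card (carrier (R Quot M)) * card M = card (carrier R)"
    using a_lagrange[OF assms is_additive_subgroup] by (simp add: FactRing_def order_def)
  moreover have "card (Units R) = card (carrier R) - card M"
    unfolding Units_eq_Diff_maximalideal[OF assms]
    using \<open>finite M\<close> a_subset by (rule card_Diff_subset)
  ultimately show ?thesis
    by (metis diff_mult_distrib2 mult.commute mult.right_neutral)
qed

text \<open>
  After the common power of \<open>p\<close> is taken out, a power of \<open>p\<close> remains in at most one argument, and
  it is coprime to the other one.
\<close>

lemma gcd_power_mult_power_mult:
  fixes p l m :: nat
  assumes "coprime p l" and "coprime p m"
  shows "gcd (p ^ h * l) (p ^ t * m) = p ^ min t h * gcd l m"
proof (cases "h \<le> t")
  case True
  then have "gcd (p ^ h * l) (p ^ t * m) = p ^ h * gcd l (p ^ (t - h) * m)"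
    by (simp add: gcd_mult_distrib_nat mult.assoc[symmetric] flip: power_add)
  also have "gcd l (p ^ (t - h) * m) = gcd l m"
    using assms(1) by (intro gcd_mult_right_left_cancel) (simp add: coprime_commute)
  finally show ?thesis
    using True by (simp add: min_def)
next
  case False
  then have "gcd (p ^ h * l) (p ^ t * m) = p ^ t * gcd (p ^ (h - t) * l) m"
    by (simp add: gcd_mult_distrib_nat mult.assoc[symmetric] flip: power_add)
  also have "gcd (p ^ (h - t) * l) m = gcd l m"
    using assms(2) by (intro gcd_mult_left_left_cancel) (simp add: coprime_commute)
  finally show ?thesis
    using False by (simp add: min_def)
qed

theorem proposition2p1:
  fixes R :: "('a, 'm) ring_scheme" and M :: "'a set" and F :: "('b, 'n) ring_scheme"
    and p q r k h l t k' l' :: nat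
  assumes "local_cring R M" and "finite (carrier R)"
    and "prime p" and "r \<ge> 1" and "q = p ^ r"
    and "field F" and "card (carrier F) = q" and "R Quot M \<simeq> F"
    and "k = p ^ h * l" and "l \<ge> 1" and "gcd l p = 1"
    and "card M = p ^ t"
    and "l' = gcd l (q - 1)" and "k' = p ^ (min t h) * l'"
  shows "unitary_cayley_graph R k = unitary_cayley_graph R k' \<and> k' \<le> k"
proof -
  interpret local_cring R M
    by fact
  have "card (carrier (R Quot M)) = q"
    using assms(7,8) bij_betw_same_card by (auto simp: is_ring_iso_def ring_iso_def)
  then have card_Units_R: "card (Units R) = p ^ t * (q - 1)"
    using card_Units[OF assms(2)] assms(12) by simp
  have "coprime (p ^ r) (p ^ r - 1)"
    using assms(3) by (intro coprime_diff_one_right_nat) (simp add: prime_gt_0_nat)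
  then have "coprime p (q - 1)"
    using assms(4,5) by (simp add: coprime_power_left_iff)
  moreover have "coprime p l"
    using assms(11) by (simp add: coprime_iff_gcd_eq_1 gcd.commute)
  ultimately have k': "k' = gcd k (card (Units R))"
    using gcd_power_mult_power_mult assms(9,13,14) card_Units_R by simp
  have "unit_powers R k = unit_powers R k'"
    unfolding unit_powers_def k' by (rule unit_powers_eq_unit_powers_gcd[OF assms(2)])
  moreover have "k > 0"
    using assms(3,9,10) by (simp add: prime_gt_0_nat)
  then have "k' \<le> k"
    unfolding k' by (intro gcd_le1_nat) simp
  ultimately show ?thesis
    by (simp add: unitary_cayley_graph_def)
qed

end
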